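(* Let $(X,d)$ be a compact metric space and let $\phi$ be a continuous flow on $X$ without singularities. If there exists a point $p\in\Omega(\phi)\setminus Per(\phi)$ which is shadowable and uniformly-expansive, then the topological entropy satisfies $h(\phi)>0$.
   Context: A continuous flow on $X$ is a continuous map $\phi:\mathbb{R}\times X\to X$, $\phi^t(x)=\phi(t,x)$, with $\phi^0=\mathrm{id}$ and $\phi^{t+s}=\phi^s\circ\phi^t$; $O(x)=\{\phi^t(x):t\in\mathbb{R}\}$. A point $x$ is periodic if there is $T>0$ with $\phi^{t+T}(x)=\phi^t(x)$ for all $t$; its period $\pi(x)$ is the infimum of such $T\ge0$, and $x$ is a singularity if $\pi(x)=0$. $Per(\phi)$ is the set of periodic points. $x$ is wandering if there are a neighborhood $U$ of $x$ and $T>0$ with $\phi^t(x)\notin U$ for all $t\ge T$; $\Omega(\phi)$ is the set of non-wandering points. A reparametrization is an increasing homeomorphism $h:\mathbb{R}\to\mathbb{R}$ with $h(0)=0$; $Rep(\phi)$ is the set of them. A sequence $(x_i,t_i)_{i=a}^b$ is a $(\delta,T)$-pseudo-orbit if $t_i\ge T$ and $d(\phi^{t_i}(x_i),x_{i+1})<\delta$ for all $i$. Put $s_i=\sum_{n=0}^{i-1}t_n$ for $i\ge0$, $s_i=-\sum_{n=i}^{-1}t_n$ for $i<0$. It is $\varepsilon$-shadowed if there are $x\in X$ and $h\in Rep(\phi)$ with $d(\phi^{h(t)}(x),\phi^{t-s_i}(x_i))<\varepsilon$ for all $i$ and $s_i\le t\le s_{i+1}$. A point $p$ is shadowable if for every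 $\varepsilon>0$ there is $\delta>0$ such that every $(\delta,1)$-pseudo-orbit $(x_i,t_i)$ with $x_0=p$ is $\varepsilon$-shadowed. A point $p$ is uniformly-expansive if there is a neighborhood $U$ of $p$ such that for every $\varepsilon>0$ there is $\delta>0$ such that whenever $y,z\in U$ and some reparametrization $h$ satisfies $d(\phi^t(y),\phi^{h(t)}(z))<\delta$ for all $t\in\mathbb{R}$, then $y=\phi^t(w)$ with $w\in O(z)$ and $|t|<\varepsilon$. Topological entropy: a set $E$ is $(t,\varepsilon)$-separated if for distinct $x,y\in E$ there is $0\le u\le t$ with $d(\phi^u(x),\phi^u(y))\ge\varepsilon$; with $s_t(X,\varepsilon)$ the maximal cardinality of such sets, $h(\phi)=\lim_{\varepsilon\to0}\limsup_{t\to\infty}\frac1t\log s_t(X,\varepsilon)$. *)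

theory Defs
  imports "HOL-Analysis.Analysis"
begin

definition is_flow :: "(real \<Rightarrow> 'a::metric_space \<Rightarrow> 'a) \<Rightarrow> bool" where
  "is_flow phi \<longleftrightarrow> continuous_on UNIV (\<lambda>(t, x). phi t x) \<and> phi 0 = id
     \<and> (\<forall>t s. phi (t + s) = phi s \<circ> phi t)"

definition orbit :: "(real \<Rightarrow> 'a \<Rightarrow> 'a) \<Rightarrow> 'a \<Rightarrow> 'a set" where
  "orbit phi x = {phi t x | t. True}"

definition periodic_pt :: "(real \<Rightarrow> 'a \<Rightarrow> 'a) \<Rightarrow> 'a \<Rightarrow> bool" where
  "periodic_pt phi x \<longleftrightarrow> (\<exists>T>0. \<forall>t. phi (t + T) x = phi t x)"

definition period :: "(real \<Rightarrow> 'a \<Rightarrow> 'a) \<Rightarrow> 'a \<Rightarrow> real" where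
  "period phi x = Inf {T. T > 0 \<and> (\<forall>t. phi (t + T) x = phi t x)}"

definition singularity :: "(real \<Rightarrow> 'a \<Rightarrow> 'a) \<Rightarrow> 'a \<Rightarrow> bool" where
  "singularity phi x \<longleftrightarrow> periodic_pt phi x \<and> period phi x = 0"

definition Per :: "(real \<Rightarrow> 'a \<Rightarrow> 'a) \<Rightarrow> 'a set" where
  "Per phi = {x. periodic_pt phi x}"

definition wandering :: "(real \<Rightarrow> 'a::topological_space \<Rightarrow> 'a) \<Rightarrow> 'a \<Rightarrow> bool" where
  "wandering phi x \<longleftrightarrow> (\<exists>U T. open U \<and> x \<in> U \<and> T > 0 \<and> (\<forall>t\<ge>T. phi t x \<notin> U))"

definition nonwandering_set :: "(real \<Rightarrow> 'a::topological_space \<Rightarrow> 'a) \<Rightarrow> 'a set" where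
  "nonwandering_set phi = {x. \<not> wandering phi x}"

definition reparam :: "(real \<Rightarrow> real) \<Rightarrow> bool" where
  "reparam h \<longleftrightarrow> strict_mono h \<and> (\<exists>g. homeomorphism UNIV UNIV h g) \<and> h 0 = 0"

definition idx :: "ereal \<Rightarrow> ereal \<Rightarrow> int set" where
  "idx a b = {i. a \<le> ereal (real_of_int i) \<and> ereal (real_of_int i) \<le> b}"

definition pseudo_orbit ::
  "(real \<Rightarrow> 'a::metric_space \<Rightarrow> 'a) \<Rightarrow> real \<Rightarrow> real \<Rightarrow> ereal \<Rightarrow> ereal \<Rightarrow> (int \<Rightarrow> 'a) \<Rightarrow> (int \<Rightarrow> real) \<Rightarrow> bool" where
  "pseudo_orbit phi \<delta> T a b x tt \<longleftrightarrow>
     (\<forall>i\<in>idx a b. tt i \<ge> T) \<and>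
     (\<forall>i. i \<in> idx a b \<and> i + 1 \<in> idx a b \<longrightarrow> dist (phi (tt i) (x i)) (x (i + 1)) < \<delta>)"

definition ssum :: "(int \<Rightarrow> real) \<Rightarrow> int \<Rightarrow> real" where
  "ssum tt i = (if i \<ge> 0 then (\<Sum>n\<in>{0..<i}. tt n) else - (\<Sum>n\<in>{i..<0}. tt n))"

definition shadowed ::
  "(real \<Rightarrow> 'a::metric_space \<Rightarrow> 'a) \<Rightarrow> real \<Rightarrow> ereal \<Rightarrow> ereal \<Rightarrow> (int \<Rightarrow> 'a) \<Rightarrow> (int \<Rightarrow> real) \<Rightarrow> bool" where
  "shadowed phi \<epsilon> a b x tt \<longleftrightarrow>
     (\<exists>y h. reparam h \<and> (\<forall>i\<in>idx a b. \<forall>t. ssum tt i \<le> t \<and> t \<le> ssum tt (i + 1) \<longrightarrow>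
        dist (phi (h t) y) (phi (t - ssum tt i) (x i)) < \<epsilon>))"

definition shadowable_pt :: "(real \<Rightarrow> 'a::metric_space \<Rightarrow> 'a) \<Rightarrow> 'a \<Rightarrow> bool" where
  "shadowable_pt phi p \<longleftrightarrow> (\<forall>\<epsilon>>0. \<exists>\<delta>>0. \<forall>a b x tt.
     a \<le> 0 \<and> 0 \<le> b \<and> pseudo_orbit phi \<delta> 1 a b x tt \<and> x 0 = p \<longrightarrow> shadowed phi \<epsilon> a b x tt)"

definition unif_expansive_pt :: "(real \<Rightarrow> 'a::metric_space \<Rightarrow> 'a) \<Rightarrow> 'a \<Rightarrow> bool" where
  "unif_expansive_pt phi p \<longleftrightarrow> (\<exists>U. open U \<and> p \<in> U \<and> (\<forall>\<epsilon>>0. \<exists>\<delta>>0. \<forall>y\<in>U. \<forall>z\<in>U. \<forall>h.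
     reparam h \<and> (\<forall>t. dist (phi t y) (phi (h t) z) < \<delta>) \<longrightarrow>
       (\<exists>w\<in>orbit phi z. \<exists>t. \<bar>t\<bar> < \<epsilon> \<and> y = phi t w)))"

definition separated :: "(real \<Rightarrow> 'a::metric_space \<Rightarrow> 'a) \<Rightarrow> real \<Rightarrow> real \<Rightarrow> 'a set \<Rightarrow> bool" where
  "separated phi t \<epsilon> E \<longleftrightarrow> (\<forall>x\<in>E. \<forall>y\<in>E. x \<noteq> y \<longrightarrow>
     (\<exists>u. 0 \<le> u \<and> u \<le> t \<and> dist (phi u x) (phi u y) \<ge> \<epsilon>))"

definition sep_num :: "(real \<Rightarrow> 'a::metric_space \<Rightarrow> 'a) \<Rightarrow> real \<Rightarrow> real \<Rightarrow> ereal" where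
  "sep_num phi t \<epsilon> = Sup {ereal (real (card E)) | E. finite E \<and> separated phi t \<epsilon> E}"

definition growth_rate :: "(real \<Rightarrow> 'a::metric_space \<Rightarrow> 'a) \<Rightarrow> real \<Rightarrow> ereal" where
  "growth_rate phi \<epsilon> = Limsup at_top (\<lambda>t::real.
     if sep_num phi t \<epsilon> = \<infinity> then \<infinity> else ereal (ln (real_of_ereal (sep_num phi t \<epsilon>)) / t))"

definition top_entropy :: "(real \<Rightarrow> 'a::metric_space \<Rightarrow> 'a) \<Rightarrow> ereal" where
  "top_entropy phi = Lim (at_right (0::real)) (\<lambda>\<epsilon>. growth_rate phi \<epsilon>)"

end

theory Submission
  imports Defs "HOL-Complex_Analysis.Great_Picard"
begin

text \<open>Since \<^term>\<open>wandering\<close> only follows the forward orbit of the point itself, \<open>p\<close> is recurrent: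
  its return times to a small ball are unbounded, and any concatenation of the corresponding loops
  of \<open>p\<close> is a pseudo-orbit, hence is shadowed. Without singularities a small time shift
  displaces every point by a definite amount, so by the intermediate value theorem an orbit that
  closely follows another one, or itself up to reparametrization, keeps pace with it.

  Fix a return time \<open>t1\<close> and let \<open>y\<close> shadow the bi-infinite repetition of the \<open>t1\<close>-loop.
  If the orbit piece of \<open>p\<close> up to some return time \<open>t\<close> does not follow \<open>y\<close> under any
  reparametrization, then free concatenations of the two loops are shadowed by points that are
  separated at the first block where the codes differ: up to that block the two reparametrizations
  agree almost exactly because the trace is the same. This gives exponential growth.

  Otherwise \<open>p\<close> follows \<open>y\<close> up to all return times. Shifting by multiples of \<open>t1\<close>
  and passing to the limit, every omega-limit point of \<open>p\<close> near \<open>p\<close> follows a point of the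
  orbit of \<open>y\<close> in both time directions, so by expansivity it lies on that orbit, which is then
  the orbit of \<open>p\<close>. By Baire's theorem this is impossible for a recurrent non-periodic
  point.\<close>

section \<open>Flows on a compact space: uniform continuity and displacement in time\<close>

locale compact_flow =
  fixes phi :: "real \<Rightarrow> 'a::metric_space \<Rightarrow> 'a"
  assumes compact_UNIV: "compact (UNIV :: 'a set)"
    and flow: "is_flow phi"
begin

lemma phi_0 [simp]: "phi 0 x = x"
  using flow by (simp add: is_flow_def)

lemma phi_add: "phi (t + s) x = phi s (phi t x)"
  using flow by (simp add: is_flow_def)

lemma continuous_on_phi:
  assumes "continuous_on S f" "continuous_on S g"
  shows "continuous_on S (\<lambda>u. phi (f u) (g u))"
proof -
  have "continuous_on UNIV (\<lambda>z. phi (fst z) (snd z))"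
    using flow by (simp add: is_flow_def case_prod_beta)
  then have "continuous_on S (\<lambda>u. (\<lambda>z. phi (fst z) (snd z)) (f u, g u))"
    by (rule continuous_on_compose2) (auto intro: continuous_on_Pair assms)
  then show ?thesis by simp
qed

lemma tendsto_phi:
  assumes "(f \<longlongrightarrow> a) F" "(g \<longlongrightarrow> b) F"
  shows "((\<lambda>u. phi (f u) (g u)) \<longlongrightarrow> phi a b) F"
proof -
  have "continuous_on UNIV (\<lambda>z. phi (fst z) (snd z))"
    by (intro continuous_on_phi continuous_intros)
  then have "isCont (\<lambda>z. phi (fst z) (snd z)) (a, b)"
    by (simp add: continuous_on_eq_continuous_at)
  from isCont_tendsto_compose[OF this tendsto_Pair[OF assms]] show ?thesis by simp
qed

lemma phi_uniformly_continuous: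
  fixes T \<beta> :: real
  assumes "\<beta> > 0"
  obtains \<kappa> where "\<kappa> > 0"
    "\<And>u v x z. \<lbrakk>\<bar>u\<bar> \<le> T; \<bar>v\<bar> \<le> T; \<bar>u - v\<bar> < \<kappa>; dist x z < \<kappa>\<rbrakk> \<Longrightarrow> dist (phi u x) (phi v z) < \<beta>"
proof -
  have "compact ({-T..T} \<times> (UNIV :: 'a set))"
    by (intro compact_Times compact_UNIV) auto
  then have "uniformly_continuous_on ({-T..T} \<times> UNIV) (\<lambda>z. phi (fst z) (snd z))"
    by (intro compact_uniformly_continuous continuous_on_phi continuous_intros)
  then obtain d where d: "d > 0"
    "\<And>w w'. \<lbrakk>w \<in> {-T..T} \<times> UNIV; w' \<in> {-T..T} \<times> UNIV; dist w' w < d\<rbrakk> \<Longrightarrow>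
       dist (phi (fst w') (snd w')) (phi (fst w) (snd w)) < \<beta>"
    unfolding uniformly_continuous_on_def using assms by metis
  show thesis
  proof
    show "d / 2 > 0" using d by simp
    fix u v x z
    assume *: "\<bar>u\<bar> \<le> T" "\<bar>v\<bar> \<le> T" "\<bar>u - v\<bar> < d / 2" "dist x (z :: 'a) < d / 2"
    have "dist (u, x) (v, z) \<le> \<bar>u - v\<bar> + dist x z"
      unfolding dist_Pair_Pair dist_real_def using sqrt_sum_squares_le_sum[of "\<bar>u - v\<bar>" "dist x z"] by simp
    then have "dist (u, x) (v, z) < d" using * by linarith
    then show "dist (phi u x) (phi v z) < \<beta>"
      using d(2)[of "(v, z)" "(u, x)"] * by (simp add: abs_le_iff)
  qed
qed

text \<open>If points \<open>x n\<close> are fixed by times \<open>u n\<close> tending to 0, integer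
  multiples of \<open>u n\<close> approximate every \<open>t > 0\<close>. An accumulation point of
  the \<open>x n\<close> is then fixed at all times, so its period is the infimum of the positive
  reals, which is 0: a singularity.\<close>

lemma fixed_times_bounded_below:
  assumes "\<forall>x. \<not> singularity phi x"
  obtains \<eta>\<^sub>0 where "\<eta>\<^sub>0 > 0" "\<And>u x. \<lbrakk>0 < u; u \<le> \<eta>\<^sub>0\<rbrakk> \<Longrightarrow> phi u x \<noteq> x"
proof -
  have "\<exists>\<eta>>0. \<forall>u x. 0 < u \<and> u \<le> \<eta> \<longrightarrow> phi u x \<noteq> x"
  proof (rule ccontr)
    assume "\<not> ?thesis"
    then have "\<forall>\<eta>>0. \<exists>u x. 0 < u \<and> u \<le> \<eta> \<and> phi u x = x" by auto
    then have "\<forall>n. \<exists>u x. 0 < u \<and> u \<le> 1 / real (Suc n) \<and> phi u x = x" by simp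
    then obtain u x where u: "\<And>n. 0 < u n" "\<And>n. u n \<le> 1 / real (Suc n)"
      and fixed: "\<And>n. phi (u n) (x n) = x n" by metis
    have u0: "u \<longlonglongrightarrow> 0"
    proof (rule tendsto_sandwich)
      show "\<forall>\<^sub>F n in sequentially. 0 \<le> u n" using u by (auto intro: always_eventually less_imp_le)
      show "\<forall>\<^sub>F n in sequentially. u n \<le> 1 / real (Suc n)" using u by auto
      show "(\<lambda>n. 1 / real (Suc n)) \<longlonglongrightarrow> 0" using LIMSEQ_inverse_real_of_nat by (simp add: inverse_eq_divide)
    qed simp
    obtain l r where r: "strict_mono (r :: nat \<Rightarrow> nat)" and l: "(x \<circ> r) \<longlonglongrightarrow> l"
      using compact_UNIV unfolding compact_def by blast
    have multiples: "phi (real k * u n) (x n) = x n" for k n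
      by (induction k) (simp_all add: distrib_right phi_add fixed)
    have "phi t l = l" if "t > 0" for t
    proof -
      \<comment> \<open>The last multiple of \<open>u (r n)\<close> not exceeding \<open>t\<close>;
        it misses \<open>t\<close> by at most \<open>u (r n)\<close>.\<close>
      define k where "k n = nat \<lfloor>t / u (r n)\<rfloor>" for n
      have k: "real (k n) * u (r n) \<le> t" "t - u (r n) \<le> real (k n) * u (r n)" for n
      proof -
        have "real (k n) = of_int \<lfloor>t / u (r n)\<rfloor>"
          unfolding k_def using that u(1)[of "r n"] by simp
        then have "real (k n) \<le> t / u (r n)" "t / u (r n) < real (k n) + 1" by linarith+
        then show "real (k n) * u (r n) \<le> t" "t - u (r n) \<le> real (k n) * u (r n)"
          using u(1)[of "r n"] by (auto simp: field_simps)
      qed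
      have "(\<lambda>n. t - u (r n)) \<longlonglongrightarrow> t - 0"
        using LIMSEQ_subseq_LIMSEQ[OF u0 r] by (intro tendsto_diff) (auto simp: o_def)
      then have "(\<lambda>n. t - u (r n)) \<longlonglongrightarrow> t" by simp
      from tendsto_sandwich[OF _ _ this tendsto_const] have "(\<lambda>n. real (k n) * u (r n)) \<longlonglongrightarrow> t"
        by (simp add: k)
      then have "(\<lambda>n. phi (real (k n) * u (r n)) (x (r n))) \<longlonglongrightarrow> phi t l"
        using l by (intro tendsto_phi) (simp_all add: o_def)
      then have "(x \<circ> r) \<longlonglongrightarrow> phi t l"
        by (simp add: multiples o_def)
      then show ?thesis
        using l LIMSEQ_unique by blast
    qed
    then have "phi (t + T) l = phi t l" if "T > 0" for t T
      using that phi_add[of T t l] by (simp add: add.commute)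
    then have "{T. T > 0 \<and> (\<forall>t. phi (t + T) l = phi t l)} = {0<..}" "periodic_pt phi l"
      unfolding periodic_pt_def using zero_less_one by blast+
    then have "singularity phi l"
      by (simp add: singularity_def period_def)
    with assms show False by blast
  qed
  with that show thesis by blast
qed

lemma displacement_bounded_below:
  assumes "\<And>x. phi \<eta> x \<noteq> x"
  obtains c where "c > 0" "\<And>x. c \<le> dist x (phi \<eta> x)"
proof -
  have "continuous_on UNIV (\<lambda>x. dist x (phi \<eta> x))"
    by (intro continuous_intros continuous_on_phi)
  then obtain x0 where "\<forall>x. dist x0 (phi \<eta> x0) \<le> dist x (phi \<eta> x)"
    using continuous_attains_inf[OF compact_UNIV] by auto
  with that[of "dist x0 (phi \<eta> x0)"] assms show thesis by (metis zero_less_dist_iff)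
qed

section \<open>Control of time drift between fellow-travelling orbits\<close>

lemma no_drift:
  fixes f g :: "real \<Rightarrow> real"
  assumes c: "\<And>x. c \<le> dist x (phi \<eta> x)" and "\<eta> > 0"
    and "a \<le> b" "continuous_on {a..b} f" "continuous_on {a..b} g" "f a = g a"
    and close: "\<And>u. u \<in> {a..b} \<Longrightarrow> dist (phi (f u) x) (phi (g u) x) < c"
  shows "\<bar>f b - g b\<bar> < \<eta>"
proof (rule ccontr)
  assume "\<not> \<bar>f b - g b\<bar> < \<eta>"
  moreover have "continuous_on {a..b} (\<lambda>u. \<bar>f u - g u\<bar>)"
    using assms by (intro continuous_intros)
  \<comment> \<open>By continuity the two times differ by exactly \<eta> somewhere; there the two
    points are a time \<eta> apart on one orbit, hence at distance at least
    \<open>c\<close>.\<close>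
  ultimately obtain u where u: "u \<in> {a..b}" "\<bar>f u - g u\<bar> = \<eta>"
    using IVT'[of "\<lambda>u. \<bar>f u - g u\<bar>" a \<eta> b] assms by auto
  show False
  proof (cases "f u \<ge> g u")
    case True
    then have "f u = g u + \<eta>" using u by simp
    then show False using c[of "phi (g u) x"] close[OF u(1)] by (simp add: phi_add dist_commute)
  next
    case False
    then have "g u = f u + \<eta>" using u by simp
    then show False using c[of "phi (f u) x"] close[OF u(1)] by (simp add: phi_add)
  qed
qed

text \<open>The matching \<open>g\<close> is only continuous, since the matchings in the limit
  argument need not be increasing. The \<open>+ 1\<close> pays for an incomplete last unit of time;
  the strict bound serves intervals of length at most 1.\<close>

definition controls_drift :: "real \<Rightarrow> real \<Rightarrow> bool" where
  "controls_drift \<kappa> \<eta> \<longleftrightarrow> (\<forall>a b g x z. a \<le> b \<and> continuous_on {a..b} g \<and>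
     (\<forall>u\<in>{a..b}. dist (phi u x) (phi (g u) z) < \<kappa>) \<longrightarrow>
     \<bar>g b - g a - (b - a)\<bar> \<le> \<eta> * (b - a + 1) \<and> (b \<le> a + 1 \<longrightarrow> \<bar>g b - g a - (b - a)\<bar> < \<eta>))"

lemma controls_driftD:
  assumes "controls_drift \<kappa> \<eta>" "a \<le> b" "continuous_on {a..b} g"
    "\<And>u. u \<in> {a..b} \<Longrightarrow> dist (phi u x) (phi (g u) z) < \<kappa>"
  shows "\<bar>g b - g a - (b - a)\<bar> \<le> \<eta> * (b - a + 1)"
    and "b \<le> a + 1 \<Longrightarrow> \<bar>g b - g a - (b - a)\<bar> < \<eta>"
  using assms unfolding controls_drift_def by blast+

text \<open>Over at most one unit of time, uniform continuity keeps
  \<open>phi (g a + (u - a)) z\<close> near \<open>phi u x\<close>, so \<open>no_drift\<close>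
  compares \<open>g\<close> with a translation along the orbit of \<open>z\<close>. Longer intervals
  are cut into unit pieces.\<close>

lemma controls_drift_exists:
  assumes c: "c > 0" "\<And>x. c \<le> dist x (phi \<eta> x)" and "\<eta> > 0"
  obtains \<kappa> where "\<kappa> > 0" "controls_drift \<kappa> \<eta>"
proof -
  obtain \<kappa>1 where \<kappa>1: "\<kappa>1 > 0"
    "\<And>u v x z. \<lbrakk>\<bar>u\<bar> \<le> 1; \<bar>v\<bar> \<le> 1; \<bar>u - v\<bar> < \<kappa>1; dist x z < \<kappa>1\<rbrakk> \<Longrightarrow> dist (phi u x) (phi v z) < c / 2"
    using phi_uniformly_continuous[of "c / 2" 1] c by auto
  define \<kappa> where "\<kappa> = min \<kappa>1 (c / 2)"
  have short: "\<bar>g b - g a - (b - a)\<bar> < \<eta>"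
    if "a \<le> b" and cont: "continuous_on {a..b} g" and "b \<le> a + 1"
      and close: "\<And>u. u \<in> {a..b} \<Longrightarrow> dist (phi u x) (phi (g u) z) < \<kappa>" for a b g x z
  proof -
    have "\<bar>g b - (g a + (b - a))\<bar> < \<eta>"
    proof (rule no_drift[OF c(2) \<open>\<eta> > 0\<close> \<open>a \<le> b\<close> cont])
      show "continuous_on {a..b} (\<lambda>u. g a + (u - a))" by (intro continuous_intros)
      fix u assume u: "u \<in> {a..b}"
      have "dist (phi (u - a) (phi a x)) (phi (u - a) (phi (g a) z)) < c / 2"
        using u that(1,3) close[of a] \<kappa>1 by (intro \<kappa>1(2)) (auto simp: \<kappa>_def)
      then have "dist (phi u x) (phi (g a + (u - a)) z) < c / 2"
        by (simp flip: phi_add)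
      moreover have "dist (phi u x) (phi (g u) z) < c / 2"
        using close[OF u] by (simp add: \<kappa>_def)
      ultimately show "dist (phi (g u) z) (phi (g a + (u - a)) z) < c"
        by metric
    qed simp
    then show ?thesis by (simp add: algebra_simps)
  qed
  have long: "\<bar>g b - g a - (b - a)\<bar> \<le> \<eta> * real n"
    if "a \<le> b" "continuous_on {a..b} g" "b \<le> a + real n"
      "\<And>u. u \<in> {a..b} \<Longrightarrow> dist (phi u x) (phi (g u) z) < \<kappa>" for a b g x z n
    using that
  proof (induction n arbitrary: b)
    case (Suc n)
    show ?case
    proof (cases "b \<le> a + 1")
      case True
      then have "\<bar>g b - g a - (b - a)\<bar> < \<eta>" using short Suc.prems by blast
      also have "\<eta> \<le> \<eta> * real (Suc n)" using \<open>\<eta> > 0\<close> by simp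
      finally show ?thesis by simp
    next
      case False
      have "\<bar>g (b - 1) - g a - (b - 1 - a)\<bar> \<le> \<eta> * real n"
        using False Suc.prems by (intro Suc.IH) (auto elim: continuous_on_subset)
      moreover have "\<bar>g b - g (b - 1) - (b - (b - 1))\<bar> < \<eta>"
        using False Suc.prems by (intro short[of _ _ _ x z]) (auto elim: continuous_on_subset)
      ultimately show ?thesis by (simp add: algebra_simps)
    qed
  qed simp
  have "\<bar>g b - g a - (b - a)\<bar> \<le> \<eta> * (b - a + 1)"
    if *: "a \<le> b" "continuous_on {a..b} g"
      "\<And>u. u \<in> {a..b} \<Longrightarrow> dist (phi u x) (phi (g u) z) < \<kappa>" for a b g x z
  proof -
    have "b \<le> a + real (nat \<lceil>b - a\<rceil>)" "real (nat \<lceil>b - a\<rceil>) \<le> b - a + 1" using *(1) by linarith+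
    then show ?thesis
      using long[OF *(1,2) _ *(3)] \<open>\<eta> > 0\<close> by (meson mult_left_mono less_imp_le order_trans)
  qed
  with short have "controls_drift \<kappa> \<eta>"
    unfolding controls_drift_def by blast
  moreover have "\<kappa> > 0" using \<kappa>1 c by (simp add: \<kappa>_def)
  ultimately show thesis using that by blast
qed

end

section \<open>Reparametrizations built from integer values, and limits of fellow travellers\<close>

lemma reparam_if_strict_mono_surj:
  assumes "strict_mono h" "surj h" "h 0 = 0"
  shows "reparam h"
proof -
  have inj: "inj h" using assms(1) strict_mono_imp_inj_on by blast
  have "strict_mono (inv h)"
    using assms strict_mono_inv_on_range by metis
  then have "continuous_on UNIV (inv h)"
    using inj by (intro continuous_onI_mono) (auto simp: inj_imp_surj_inv strict_mono_less_eq)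
  moreover have "continuous_on UNIV h"
    using assms by (intro continuous_onI_mono) (auto simp: strict_mono_less_eq)
  ultimately have "homeomorphism UNIV UNIV h (inv h)"
    using inj assms by (auto simp: homeomorphism_def inj_imp_surj_inv surj_f_inv_f)
  with assms show ?thesis unfolding reparam_def by blast
qed

text \<open>The piecewise linear map through the points \<open>(k, a k)\<close>.\<close>

definition interpolate :: "(int \<Rightarrow> real) \<Rightarrow> real \<Rightarrow> real" where
  "interpolate a t = a \<lfloor>t\<rfloor> + frac t * (a (\<lfloor>t\<rfloor> + 1) - a \<lfloor>t\<rfloor>)"

text \<open>All slopes are at least \<open>1 - \<eta> > 0\<close>, which gives strict monotonicity
  and unboundedness in both directions.\<close>

lemma reparam_interpolate:
  fixes a :: "int \<Rightarrow> real"
  assumes step: "\<And>k. \<bar>a (k + 1) - a k - 1\<bar> \<le> \<eta>" and "\<eta> < 1" and a0: "a 0 = 0"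
  shows "reparam (interpolate a)"
proof (rule reparam_if_strict_mono_surj)
  have inc: "a (k + 1) - a k \<ge> 1 - \<eta>" for k using step[of k] by (simp add: abs_le_iff)
  have grow: "a k + (1 - \<eta>) * (of_int l - of_int k) \<le> a l" if "k \<le> l" for k l
    using that
  proof (induction l rule: int_ge_induct)
    case (step l)
    then show ?case using inc[of l] by (simp add: algebra_simps)
  qed simp
  have mono: "a k \<le> a l" if "k \<le> l" for k l
  proof -
    have "0 \<le> (1 - \<eta>) * (of_int l - of_int k)" using that \<open>\<eta> < 1\<close> by simp
    then show ?thesis using grow[OF that] by linarith
  qed
  have lower: "a \<lfloor>t\<rfloor> \<le> interpolate a t" for t
    using inc[of "\<lfloor>t\<rfloor>"] \<open>\<eta> < 1\<close> frac_ge_0[of t] by (simp add: interpolate_def)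
  have upper: "interpolate a t < a (\<lfloor>t\<rfloor> + 1)" for t
  proof -
    have "frac t * (a (\<lfloor>t\<rfloor> + 1) - a \<lfloor>t\<rfloor>) < 1 * (a (\<lfloor>t\<rfloor> + 1) - a \<lfloor>t\<rfloor>)"
      using inc[of "\<lfloor>t\<rfloor>"] \<open>\<eta> < 1\<close> frac_lt_1[of t] by (intro mult_strict_right_mono) auto
    then show ?thesis by (simp add: interpolate_def)
  qed
  show "strict_mono (interpolate a)"
  proof
    fix x y :: real assume "x < y"
    show "interpolate a x < interpolate a y"
    proof (cases "\<lfloor>x\<rfloor> = \<lfloor>y\<rfloor>")
      case True
      then have "frac x * (a (\<lfloor>y\<rfloor> + 1) - a \<lfloor>y\<rfloor>) < frac y * (a (\<lfloor>y\<rfloor> + 1) - a \<lfloor>y\<rfloor>)"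
        using inc[of "\<lfloor>y\<rfloor>"] \<open>\<eta> < 1\<close> \<open>x < y\<close>
        by (intro mult_strict_right_mono) (auto simp: frac_def)
      then show ?thesis using True by (simp add: interpolate_def)
    next
      case False
      then have "\<lfloor>x\<rfloor> + 1 \<le> \<lfloor>y\<rfloor>" using \<open>x < y\<close> floor_mono[of x y] by linarith
      then show ?thesis using mono upper[of x] lower[of y] by (meson less_le_trans order_trans)
    qed
  qed
  show "surj (interpolate a)"
    unfolding surj_def
  proof
    fix v :: real
    obtain m :: nat where m: "real m * (1 - \<eta>) > \<bar>v\<bar>"
      using ex_less_of_nat_mult[of "1 - \<eta>" "\<bar>v\<bar>"] \<open>\<eta> < 1\<close> by auto
    have "a (- int m) \<le> v" "v < a (int m)"
      using grow[of "- int m" 0] grow[of 0 "int m"] m a0 by (auto simp: algebra_simps)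
    \<comment> \<open>Discrete intermediate value argument: otherwise \<open>a l \<le> v\<close>
      would propagate from \<open>- m\<close> to \<open>m\<close>.\<close>
    have "\<exists>k. a k \<le> v \<and> v < a (k + 1)"
    proof (rule ccontr)
      assume *: "\<not> ?thesis"
      have "a l \<le> v" if "l \<ge> - int m" for l
        using that by (induction l rule: int_ge_induct) (use * \<open>a (- int m) \<le> v\<close> in force)+
      from this[of "int m"] \<open>v < a (int m)\<close> show False by simp
    qed
    then obtain k where k: "a k \<le> v" "v < a (k + 1)" by blast
    define s where "s = (v - a k) / (a (k + 1) - a k)"
    have s: "0 \<le> s" "s < 1" "s * (a (k + 1) - a k) = v - a k"
      using k by (auto simp: s_def)
    have "\<lfloor>of_int k + s\<rfloor> = k" using s by (simp add: floor_eq_iff)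
    then show "\<exists>t. v = interpolate a t"
      using s by (intro exI[of _ "of_int k + s"]) (simp add: interpolate_def frac_def)
  qed
  show "interpolate a 0 = 0" by (simp add: interpolate_def a0)
qed

context compact_flow
begin

text \<open>The \<open>G n\<close> need not be equicontinuous, so limits are taken at integer times
  only. Drift control bounds these values and makes the limits nearly unit-spaced; interpolation
  then yields a reparametrization, and uniform continuity restores closeness between the
  integers.\<close>

lemma limit_of_fellow_travellers:
  assumes "\<forall>x. \<not> singularity phi x" and "\<delta> > 0"
  obtains \<kappa> where "\<kappa> > 0"
    "\<And>x q y G B. \<lbrakk>x \<longlonglongrightarrow> q; \<And>n. continuous_on UNIV (G n); \<And>n. \<bar>G n 0\<bar> \<le> B;
      \<And>n u. \<bar>u\<bar> \<le> real n \<Longrightarrow> dist (phi u (x n)) (phi (G n u) y) < \<kappa>\<rbrakk> \<Longrightarrow>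
      \<exists>v h. reparam h \<and> (\<forall>t. dist (phi t q) (phi (h t) (phi v y)) < \<delta>)"
proof -
  obtain \<eta>\<^sub>0 where \<eta>\<^sub>0: "\<eta>\<^sub>0 > 0" "\<And>u x. \<lbrakk>0 < u; u \<le> \<eta>\<^sub>0\<rbrakk> \<Longrightarrow> phi u x \<noteq> x"
    using fixed_times_bounded_below[OF assms(1)] by blast
  obtain \<kappa>1 where \<kappa>1: "\<kappa>1 > 0"
    "\<And>u v x z. \<lbrakk>\<bar>u\<bar> \<le> 2; \<bar>v\<bar> \<le> 2; \<bar>u - v\<bar> < \<kappa>1; dist x z < \<kappa>1\<rbrakk> \<Longrightarrow> dist (phi u x) (phi v z) < \<delta>"
    using phi_uniformly_continuous[OF \<open>\<delta> > 0\<close>, of 2] by blast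
  \<comment> \<open>The three bounds give a positive displacement at time \<eta>, tolerate the time
    error inside a unit interval, and keep the slopes positive with \<open>s * e\<close> in the
    range of \<open>\<kappa>1\<close>.\<close>
  define \<eta> where "\<eta> = min \<eta>\<^sub>0 (min (\<kappa>1 / 2) (1 / 2))"
  have \<eta>: "0 < \<eta>" "\<eta> \<le> \<eta>\<^sub>0" "\<eta> < \<kappa>1" "\<eta> \<le> 1 / 2" using \<eta>\<^sub>0 \<kappa>1 by (auto simp: \<eta>_def)
  obtain c where c: "c > 0" "\<And>x. c \<le> dist x (phi \<eta> x)"
    using displacement_bounded_below[of \<eta>] \<eta>\<^sub>0(2) \<eta> by metis
  obtain \<kappa>2 where \<kappa>2: "\<kappa>2 > 0" "controls_drift \<kappa>2 \<eta>"
    using controls_drift_exists[OF c \<eta>(1)] by blast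
  define \<kappa> where "\<kappa> = min (\<kappa>1 / 2) \<kappa>2"
  have "\<exists>v h. reparam h \<and> (\<forall>t. dist (phi t q) (phi (h t) (phi v y)) < \<delta>)"
    if x: "x \<longlonglongrightarrow> q" and cont: "\<And>n. continuous_on UNIV (G n)" and B: "\<And>n. \<bar>G n 0\<bar> \<le> B"
      and close: "\<And>n u. \<bar>u\<bar> \<le> real n \<Longrightarrow> dist (phi u (x n)) (phi (G n u) y) < \<kappa>"
    for x q y G and B :: real
  proof -
    have cont': "continuous_on S (G n)" for S n
      using cont continuous_on_subset by blast
    have close': "dist (phi u (x n)) (phi (G n u) y) < \<kappa>2" if "\<bar>u\<bar> \<le> real n" for u n
      using close[OF that] by (simp add: \<kappa>_def)
    have size: "\<bar>G n (of_int k)\<bar> \<le> B + 2 * \<bar>of_int k\<bar> + 1" if "\<bar>k\<bar> \<le> int n" for n k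
    proof -
      have kn: "\<bar>of_int k\<bar> \<le> real n" using that by linarith
      have "\<bar>G n (of_int k) - G n 0 - of_int k\<bar> \<le> \<eta> * (\<bar>of_int k\<bar> + 1)"
      proof (cases "k \<ge> 0")
        case True
        then show ?thesis using controls_driftD(1)[OF \<kappa>2(2), of 0 "of_int k" "G n" "x n" y] cont' close' kn by force
      next
        case False
        then show ?thesis using controls_driftD(1)[OF \<kappa>2(2), of "of_int k" 0 "G n" "x n" y] cont' close' kn by force
      qed
      moreover have "\<eta> * (\<bar>of_int k\<bar> + 1) \<le> 1 * (\<bar>of_int k\<bar> + 1)"
        using \<eta> by (intro mult_right_mono) auto
      moreover have "\<bar>G n (of_int k)\<bar> \<le> \<bar>G n (of_int k) - G n 0 - of_int k\<bar> + \<bar>G n 0\<bar> + \<bar>of_int k\<bar>"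
        by linarith
      ultimately show ?thesis using B[of n] by simp
    qed
    define w :: "int \<Rightarrow> real" where "w k = B + 2 * \<bar>of_int k\<bar> + 1" for k
    have w: "w k > 0" for k using B[of 0] by (simp add: w_def)
    \<comment> \<open>Dividing by the bound \<open>w k\<close> and cutting off where nothing is
      known puts all entries into \<open>[-1, 1]\<close>, so one subsequence converges at every
      integer.\<close>
    define f where "f n k = (if \<bar>k\<bar> \<le> int n then G n (of_int k) / w k else 0)" for n k
    have "norm (f n k) \<le> 1" for n k
      using size[of k n] w[of k] by (auto simp: f_def w_def)
    then obtain r l where r: "strict_mono (r :: nat \<Rightarrow> nat)" and l: "\<And>k. (\<lambda>n. f (r n) k) \<longlonglongrightarrow> l k"
      using function_convergent_subsequence[of "UNIV :: int set" f 1] by (metis UNIV_I countableI_type)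
    define a where "a k = l k * w k" for k
    have ev: "\<forall>\<^sub>F n in sequentially. real_of_int \<bar>k\<bar> \<le> real (r n)" for k
    proof -
      have "\<forall>\<^sub>F n in sequentially. nat \<bar>k\<bar> \<le> n" by (rule eventually_ge_at_top)
      then show ?thesis
      proof eventually_elim
        case (elim n)
        then show ?case using seq_suble[OF r, of n] by linarith
      qed
    qed
    have a: "(\<lambda>n. G (r n) (of_int k)) \<longlonglongrightarrow> a k" for k
    proof (rule Lim_transform_eventually)
      show "(\<lambda>n. f (r n) k * w k) \<longlonglongrightarrow> a k" unfolding a_def by (intro tendsto_intros l)
      show "\<forall>\<^sub>F n in sequentially. f (r n) k * w k = G (r n) (of_int k)"
        using ev[of k] by eventually_elim (use w[of k] in \<open>simp add: f_def\<close>)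
    qed
    have xr: "(\<lambda>n. x (r n)) \<longlonglongrightarrow> q"
      using LIMSEQ_subseq_LIMSEQ[OF x r] by (simp add: o_def)
    have step: "\<bar>a (k + 1) - a k - 1\<bar> \<le> \<eta>" for k
    proof (rule tendsto_upperbound)
      show "(\<lambda>n. \<bar>G (r n) (of_int (k + 1)) - G (r n) (of_int k) - 1\<bar>) \<longlonglongrightarrow> \<bar>a (k + 1) - a k - 1\<bar>"
        by (intro tendsto_intros a)
      show "\<forall>\<^sub>F n in sequentially. \<bar>G (r n) (of_int (k + 1)) - G (r n) (of_int k) - 1\<bar> \<le> \<eta>"
        using ev[of k] ev[of "k + 1"]
      proof eventually_elim
        case (elim n)
        have "\<bar>G (r n) (of_int (k + 1)) - G (r n) (of_int k) - (of_int (k + 1) - of_int k)\<bar> < \<eta>"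
          using elim by (intro controls_driftD(2)[OF \<kappa>2(2), where x = "x (r n)" and z = y] cont' close') auto
        then show ?case by simp
      qed
    qed simp
    \<comment> \<open>The limit preserves only the weak inequality;
      \<open>\<kappa> \<le> \<kappa>1 / 2\<close> makes it strict again.\<close>
    have near: "dist (phi (of_int k) q) (phi (a k) y) < \<kappa>1" for k
    proof -
      have "dist (phi (of_int k) q) (phi (a k) y) \<le> \<kappa>"
      proof (rule tendsto_upperbound)
        show "(\<lambda>n. dist (phi (of_int k) (x (r n))) (phi (G (r n) (of_int k)) y))
          \<longlonglongrightarrow> dist (phi (of_int k) q) (phi (a k) y)"
          by (intro tendsto_dist tendsto_phi tendsto_const xr a)
        show "\<forall>\<^sub>F n in sequentially. dist (phi (of_int k) (x (r n))) (phi (G (r n) (of_int k)) y) \<le> \<kappa>"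
          using ev[of k] by eventually_elim (use close less_imp_le in auto)
      qed simp
      then show ?thesis using \<kappa>1(1) unfolding \<kappa>_def by linarith
    qed
    \<comment> \<open>Subtracting \<open>a 0\<close> makes the map fix 0; the base point
      \<open>phi (a 0) y\<close> compensates for it.\<close>
    define h where "h = interpolate (\<lambda>k. a k - a 0)"
    have "reparam h"
      unfolding h_def by (rule reparam_interpolate[of _ \<eta>]) (use step \<eta> in auto)
    moreover have "dist (phi t q) (phi (h t) (phi (a 0) y)) < \<delta>" for t
    proof -
      define k where "k = \<lfloor>t\<rfloor>"
      define s where "s = frac t"
      define e where "e = a (k + 1) - a k"
      have e: "\<bar>1 - e\<bar> \<le> \<eta>" using step[of k] by (auto simp: e_def)
      have s: "0 \<le> s" "s < 1" by (auto simp: s_def frac_lt_1)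
      have se: "\<bar>s * (1 - e)\<bar> \<le> \<eta>"
      proof -
        have "\<bar>s * (1 - e)\<bar> \<le> 1 * \<bar>1 - e\<bar>"
          unfolding abs_mult using s by (intro mult_right_mono) auto
        with e show ?thesis by simp
      qed
      have "\<bar>s * e\<bar> \<le> 2" using se s \<eta> by (auto simp: algebra_simps)
      moreover have "\<bar>s - s * e\<bar> < \<kappa>1" using se \<eta> by (simp add: algebra_simps)
      ultimately have "dist (phi s (phi (of_int k) q)) (phi (s * e) (phi (a k) y)) < \<delta>"
        using s near by (intro \<kappa>1(2)) auto
      moreover have "t = of_int k + s" by (simp add: k_def s_def frac_def)
      moreover have "a 0 + h t = a k + s * e"
        by (simp add: h_def interpolate_def k_def s_def e_def)
      ultimately show ?thesis by (metis phi_add)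
    qed
    ultimately show ?thesis by blast
  qed
  moreover have "\<kappa> > 0" using \<kappa>1 \<kappa>2 by (simp add: \<kappa>_def)
  ultimately show thesis using that by blast
qed

end

section \<open>Entropy from separated sets\<close>

lemma sep_num_antimono:
  assumes "\<epsilon>' \<le> \<epsilon>"
  shows "sep_num phi t \<epsilon> \<le> sep_num phi t \<epsilon>'"
proof -
  have "separated phi t \<epsilon>' E" if "separated phi t \<epsilon> E" for E
    using that assms unfolding separated_def by (meson order_trans)
  then show ?thesis
    unfolding sep_num_def by (intro Sup_subset_mono) blast
qed

text \<open>Excludes 0 and \<open>-\<infinity>\<close>, so that \<open>ln\<close> is applied only
  where it is monotone.\<close>

lemma sep_num_ge_1:
  fixes phi :: "real \<Rightarrow> 'a::metric_space \<Rightarrow> 'a"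
  shows "1 \<le> sep_num phi t \<epsilon>"
proof -
  have "ereal (real (card {x})) \<le> sep_num phi t \<epsilon>" for x :: 'a
    unfolding sep_num_def
    by (intro Sup_upper CollectI exI[of _ "{x}"]) (simp add: separated_def)
  then show ?thesis by (simp add: one_ereal_def)
qed

lemma growth_rate_antimono:
  assumes "\<epsilon>' \<le> \<epsilon>"
  shows "growth_rate phi \<epsilon> \<le> growth_rate phi \<epsilon>'"
  unfolding growth_rate_def
proof (rule Limsup_mono)
  show "\<forall>\<^sub>F t in at_top.
      (if sep_num phi t \<epsilon> = \<infinity> then \<infinity> else ereal (ln (real_of_ereal (sep_num phi t \<epsilon>)) / t))
      \<le> (if sep_num phi t \<epsilon>' = \<infinity> then \<infinity> else ereal (ln (real_of_ereal (sep_num phi t \<epsilon>')) / t))"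
    using eventually_gt_at_top[of 0]
  proof eventually_elim
    case (elim t)
    show ?case
      using sep_num_antimono[OF assms, of phi t] sep_num_ge_1[of phi t \<epsilon>] sep_num_ge_1[of phi t \<epsilon>'] elim
      by (cases "sep_num phi t \<epsilon>"; cases "sep_num phi t \<epsilon>'")
        (auto simp: one_ereal_def intro!: divide_right_mono)
  qed
qed

text \<open>By antitonicity the right limit at 0 exists and is the supremum, so \<open>Lim\<close>
  denotes a genuine limit.\<close>

lemma growth_rate_le_top_entropy:
  assumes "\<epsilon> > 0"
  shows "growth_rate phi \<epsilon> \<le> top_entropy phi"
proof -
  define l where "l = (SUP e\<in>{0<..}. growth_rate phi e)"
  have "(growth_rate phi \<longlongrightarrow> l) (at_right 0)"
  proof (rule increasing_tendsto)
    show "\<forall>\<^sub>F e in at_right 0. growth_rate phi e \<le> l"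
      using eventually_at_right_less[of 0] by eventually_elim (auto simp: l_def intro: SUP_upper)
    fix x assume "x < l"
    then obtain e where e: "e > 0" "x < growth_rate phi e"
      by (auto simp: l_def less_SUP_iff)
    have "\<forall>\<^sub>F e' in at_right 0. e' < e"
      using e by (auto simp: eventually_at_right_field)
    then show "\<forall>\<^sub>F e' in at_right 0. x < growth_rate phi e'"
      by eventually_elim (meson e(2) growth_rate_antimono less_imp_le less_le_trans)
  qed
  then have "top_entropy phi = l"
    unfolding top_entropy_def by (intro tendsto_Lim) auto
  then show ?thesis using assms by (auto simp: l_def intro: SUP_upper)
qed

text \<open>At the times \<open>N * M\<close>, which are unbounded, the quotient is at least
  \<open>ln 2 / M\<close>.\<close>

lemma growth_rate_pos:
  assumes "M > 0"
    and "\<And>N. N \<ge> 1 \<Longrightarrow> \<exists>E. finite E \<and> card E = 2 ^ N \<and> separated phi (real N * M) \<epsilon> E"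
  shows "growth_rate phi \<epsilon> > 0"
proof (rule ccontr)
  define b where "b = ln 2 / M"
  have b: "b > 0" using \<open>M > 0\<close> by (simp add: b_def)
  assume "\<not> ?thesis"
  then have "growth_rate phi \<epsilon> < ereal b"
    using b by (meson ereal_less(2) leI le_less_trans)
  then have "\<forall>\<^sub>F t in at_top.
      (if sep_num phi t \<epsilon> = \<infinity> then \<infinity> else ereal (ln (real_of_ereal (sep_num phi t \<epsilon>)) / t)) < ereal b"
    unfolding growth_rate_def by (rule Limsup_lessD)
  then obtain K where K: "\<And>t. t \<ge> K \<Longrightarrow>
      (if sep_num phi t \<epsilon> = \<infinity> then \<infinity> else ereal (ln (real_of_ereal (sep_num phi t \<epsilon>)) / t)) < ereal b"
    by (auto simp: eventually_at_top_linorder)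
  obtain N0 :: nat where "K / M \<le> real N0" using real_arch_simple by blast
  define N where "N = Suc N0"
  have N: "N \<ge> 1" "real N * M \<ge> K"
    using \<open>K / M \<le> real N0\<close> \<open>M > 0\<close> by (auto simp: N_def field_simps)
  obtain E where E: "finite E" "card E = 2 ^ N" "separated phi (real N * M) \<epsilon> E"
    using assms(2) N by blast
  then have "ereal (real (card E)) \<le> sep_num phi (real N * M) \<epsilon>"
    unfolding sep_num_def by (intro Sup_upper) blast
  \<comment> \<open>An infinite \<open>sep_num\<close> would contradict \<open>K\<close>, so its
    value is a real \<open>s\<close>.\<close>
  with K[OF N(2)] E(2) obtain s where s: "sep_num phi (real N * M) \<epsilon> = ereal s" "2 ^ N \<le> s"
    by (cases "sep_num phi (real N * M) \<epsilon>") auto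
  have "real N * ln 2 = ln (2 ^ N :: real)" by (simp add: ln_realpow)
  also have "\<dots> \<le> ln s" using s(2) by (intro ln_mono) (auto intro: less_le_trans[of 0 "2 ^ N"])
  finally have "b \<le> ln s / (real N * M)"
    using N \<open>M > 0\<close> by (simp add: b_def field_simps)
  with K[OF N(2)] s(1) show False by simp
qed

section \<open>Recurrence, and omega-limit points off the orbit\<close>

lemma nonwandering_recurrent:
  assumes "p \<in> nonwandering_set phi" "open V" "p \<in> V"
  shows "\<exists>t\<ge>T. phi t p \<in> V"
proof -
  \<comment> \<open>The maximum is there because \<open>wandering\<close> asks for a positive
    time.\<close>
  have "\<exists>t\<ge>max T 1. phi t p \<in> V"
    using assms unfolding nonwandering_set_def wandering_def
    by (auto dest!: spec[of _ V] spec[of _ "max T 1"])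
  then show ?thesis by auto
qed

context compact_flow
begin

lemma compact_orbit_segment: "compact ((\<lambda>t. phi t x) ` {a..b})"
  by (intro compact_continuous_image continuous_on_phi continuous_intros) simp

text \<open>Baire: a compact orbit segment has empty interior in the omega-limit set, since the orbit of
  \<open>p\<close> returns to every open subset at arbitrarily late times without repeating points.\<close>

lemma omega_limit_point_off_orbit:
  assumes recurrent: "p \<in> nonwandering_set phi" and nonper: "p \<notin> Per phi" and "\<rho> > 0"
  obtains q where "dist p q < \<rho>" "q \<notin> orbit phi p"
    "\<And>V T. open V \<Longrightarrow> q \<in> V \<Longrightarrow> \<exists>t\<ge>T. phi t p \<in> V"
proof -
  \<comment> \<open>The omega-limit set of \<open>p\<close>; it is closed and, by recurrence,
    contains the orbit of \<open>p\<close>.\<close>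
  define W where "W = {q. \<forall>V T. open V \<and> q \<in> V \<longrightarrow> (\<exists>t\<ge>T. phi t p \<in> V)}"
  have rec: "\<exists>t\<ge>T. phi t p \<in> V" if "open V" "p \<in> V" for V T
    using nonwandering_recurrent[OF recurrent that] .
  have orbit_in_W: "phi s p \<in> W" for s
    unfolding W_def
  proof safe
    fix V :: "'a set" and T
    assume V: "open V" "phi s p \<in> V"
    have "open (phi s -` V)"
      by (intro open_vimage V continuous_on_phi continuous_intros)
    then obtain t where "t \<ge> T - s" "phi t p \<in> phi s -` V"
      using rec[of "phi s -` V" "T - s"] V by auto
    then show "\<exists>t\<ge>T. phi t p \<in> V"
      by (intro exI[of _ "t + s"]) (auto simp: phi_add)
  qed
  have "open (- W)"
  proof (subst open_subopen, safe)
    fix q assume "q \<notin> W"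
    then obtain V T where "open V" "q \<in> V" "\<not> (\<exists>t\<ge>T. phi t p \<in> V)" unfolding W_def by blast
    then show "\<exists>V. open V \<and> q \<in> V \<and> V \<subseteq> - W" unfolding W_def by blast
  qed
  then have "closed W" by (simp add: closed_def)
  then have "compact W" using compact_UNIV compact_Int_closed by fastforce
  then have compact_W: "compact_space (top_of_set W)" by (simp add: compact_space_subtopology)
  have Hausdorff_W: "Hausdorff_space (top_of_set W)"
    by (simp add: Hausdorff_space_subtopology)
  define C where "C m = (\<lambda>t. phi t p) ` {- real m..real m}" for m
  have C_sub: "C m \<subseteq> W" for m using orbit_in_W by (auto simp: C_def)
  have "top_of_set W interior_of \<Union>(range C) = {}"
  proof (rule Baire_category_alt)
    show "completely_metrizable_space (top_of_set W) \<or>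
        locally_compact_space (top_of_set W) \<and> regular_space (top_of_set W)"
      using compact_W Hausdorff_W compact_imp_locally_compact_space
        compact_Hausdorff_imp_regular_space by blast
    fix S assume "S \<in> range C"
    then obtain m where m: "S = C m" by blast
    have "closed (C m)" unfolding C_def by (intro compact_imp_closed compact_orbit_segment)
    then have "closedin (top_of_set W) S"
      unfolding m using C_sub closed_subset by blast
    moreover have "top_of_set W interior_of S = {}"
    proof (rule ccontr)
      assume "\<not> ?thesis"
      then obtain V w where V: "open V" "w \<in> V" "w \<in> W" "W \<inter> V \<subseteq> C m"
        unfolding interior_of_def m openin_open by fast
      then obtain t where t: "t \<ge> real m + 1" "phi t p \<in> V" unfolding W_def by blast
      then obtain u where u: "u \<le> real m" "phi t p = phi u p"
        using V orbit_in_W by (force simp: C_def)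
      have "phi (s + (t - u)) p = phi s p" for s
      proof -
        have "phi (s + (t - u)) p = phi (s - u) (phi t p)"
          by (simp flip: phi_add add: algebra_simps)
        also have "\<dots> = phi s p" by (simp add: u(2) flip: phi_add)
        finally show ?thesis .
      qed
      moreover have "t - u > 0" using t u by simp
      ultimately show False using nonper unfolding Per_def periodic_pt_def by blast
    qed
    ultimately show "closedin (top_of_set W) S \<and> top_of_set W interior_of S = {}" by blast
  qed simp
  \<comment> \<open>A nonempty open subset of \<open>W\<close> is not covered by the segments
    \<open>C m\<close>, whose union contains the orbit; an uncovered point is the required
    \<open>q\<close>.\<close>
  moreover have "openin (top_of_set W) (W \<inter> ball p \<rho>)" by (simp add: openin_open_Int)
  moreover have "p \<in> W \<inter> ball p \<rho>" using orbit_in_W[of 0] \<open>\<rho> > 0\<close> by simp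
  ultimately have "\<not> W \<inter> ball p \<rho> \<subseteq> \<Union>(range C)"
    by (metis empty_iff interior_of_maximal subsetD)
  moreover have "orbit phi p \<subseteq> \<Union>(range C)"
  proof
    fix q assume "q \<in> orbit phi p"
    then obtain t where "q = phi t p" unfolding orbit_def by blast
    moreover obtain m :: nat where "\<bar>t\<bar> \<le> real m" using real_arch_simple by blast
    ultimately show "q \<in> \<Union>(range C)" by (force simp: C_def abs_le_iff)
  qed
  ultimately show thesis using that unfolding W_def by fastforce
qed

end

section \<open>Pseudo-orbits made of loops\<close>

lemma ssum_0 [simp]: "ssum tt 0 = 0"
  by (simp add: ssum_def)

lemma ssum_add_1: "ssum tt (i + 1) = ssum tt i + tt i"
proof (cases "i \<ge> 0")
  case True
  then have "{0..<i + 1} = insert i {0..<i}" by auto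
  with True show ?thesis by (simp add: ssum_def)
next
  case False
  then have "{i..<0} = insert i {i + 1..<0}" by auto
  \<comment> \<open>For \<open>i = -1\<close> the index \<open>i + 1 = 0\<close> falls into the
    first branch of \<open>ssum\<close>.\<close>
  with False show ?thesis by (cases "i = -1") (auto simp: ssum_def)
qed

lemma ssum_const: "ssum (\<lambda>_. c) i = of_int i * c"
  by (simp add: ssum_def)

lemma ssum_le:
  assumes "\<And>i. tt i \<le> m" "i \<ge> 0"
  shows "ssum tt i \<le> m * of_int i"
  using assms(2)
  by (induction i rule: int_ge_induct) (use assms(1) in \<open>simp_all add: ssum_add_1 algebra_simps add_mono\<close>)

lemma ssum_cong:
  assumes "\<And>j. \<lbrakk>0 \<le> j; j < i\<rbrakk> \<Longrightarrow> tt j = tt' j" "i \<ge> 0"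
  shows "ssum tt i = ssum tt' i"
  using assms by (simp add: ssum_def)

lemma ssum_cover:
  assumes "0 \<le> u" "u < ssum tt n" "n \<ge> 0"
  obtains i where "0 \<le> i" "i < n" "ssum tt i \<le> u" "u \<le> ssum tt (i + 1)"
proof -
  have "\<exists>i. 0 \<le> i \<and> i < n \<and> ssum tt i \<le> u \<and> u \<le> ssum tt (i + 1)"
    using assms(3,2)
  proof (induction n rule: int_ge_induct)
    case base
    then show ?case using assms(1) by simp
  next
    case (step n)
    show ?case
    proof (cases "u < ssum tt n")
      case True
      then obtain i where "0 \<le> i" "i < n" "ssum tt i \<le> u" "u \<le> ssum tt (i + 1)" using step by blast
      then show ?thesis by (intro exI[of _ i]) simp
    next
      case False
      then show ?thesis using step by (intro exI[of _ n]) simp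
    qed
  qed
  with that show thesis by blast
qed

lemma reparam_continuous_on: "reparam h \<Longrightarrow> continuous_on S h"
  unfolding reparam_def by (meson homeomorphism_cont1 continuous_on_subset subset_UNIV)

lemma reparam_inverse:
  assumes "reparam h"
  obtains h' where "continuous_on UNIV h'" "\<And>t. h (h' t) = t"
  using assms unfolding reparam_def homeomorphism_def by auto

lemma reparam_less_iff: "reparam h \<Longrightarrow> h s < h t \<longleftrightarrow> s < t"
  and reparam_le_iff: "reparam h \<Longrightarrow> h s \<le> h t \<longleftrightarrow> s \<le> t"
  unfolding reparam_def by (auto simp: strict_mono_less strict_mono_less_eq)

text \<open>The pseudo-orbit is constantly \<open>p\<close>; its \<open>i\<close>-th piece is the loop of \<open>p\<close> of duration
  \<open>tt i\<close>, starting at time \<open>ssum tt i\<close>.\<close>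

definition shadows_loops ::
  "(real \<Rightarrow> 'a::metric_space \<Rightarrow> 'a) \<Rightarrow> real \<Rightarrow> 'a \<Rightarrow> (int \<Rightarrow> real) \<Rightarrow> 'a \<Rightarrow> (real \<Rightarrow> real) \<Rightarrow> bool" where
  "shadows_loops phi \<epsilon> p tt y h \<longleftrightarrow> reparam h \<and>
     (\<forall>i u. 0 \<le> u \<and> u \<le> tt i \<longrightarrow> dist (phi (h (ssum tt i + u)) y) (phi u p) < \<epsilon>)"

text \<open>Durations of near returns make the constant sequence \<open>p\<close> a bi-infinite
  pseudo-orbit. The same \<delta> serves every choice of durations, so loops may be concatenated
  freely.\<close>

lemma shadows_loops_exists:
  assumes "shadowable_pt phi p" "\<epsilon> > 0"
  obtains \<delta> where "\<delta> > 0"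
    "\<And>tt. (\<And>i. tt i \<ge> 1 \<and> dist (phi (tt i) p) p < \<delta>) \<Longrightarrow> \<exists>y h. shadows_loops phi \<epsilon> p tt y h"
proof -
  obtain \<delta> where "\<delta> > 0" and \<delta>: "\<And>a b x tt. \<lbrakk>a \<le> 0; 0 \<le> b; pseudo_orbit phi \<delta> 1 a b x tt; x 0 = p\<rbrakk> \<Longrightarrow>
      shadowed phi \<epsilon> a b x tt"
    using assms unfolding shadowable_pt_def by metis
  have "\<exists>y h. shadows_loops phi \<epsilon> p tt y h" if "\<And>i. tt i \<ge> 1 \<and> dist (phi (tt i) p) p < \<delta>" for tt
  proof -
    have "shadowed phi \<epsilon> (-\<infinity>) \<infinity> (\<lambda>_. p) tt"
      using that by (intro \<delta>) (auto simp: pseudo_orbit_def)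
    then obtain y h where h: "reparam h" and close: "\<And>i t. \<lbrakk>ssum tt i \<le> t; t \<le> ssum tt (i + 1)\<rbrakk> \<Longrightarrow>
        dist (phi (h t) y) (phi (t - ssum tt i) p) < \<epsilon>"
      unfolding shadowed_def idx_def by auto
    have "dist (phi (h (ssum tt i + u)) y) (phi u p) < \<epsilon>" if "0 \<le> u" "u \<le> tt i" for i u
      using close[of i "ssum tt i + u"] that by (simp add: ssum_add_1)
    with h show ?thesis unfolding shadows_loops_def by blast
  qed
  with \<open>\<delta> > 0\<close> that show thesis by blast
qed

section \<open>Exponential growth from two incomparable loops\<close>

context compact_flow
begin

text \<open>Sets of block indices serve as codes. Where two codes first differ, one trace runs
  through the \<open>t\<close>-loop while the other runs through \<open>t1\<close>-loops; if the
  traces stayed \<epsilon>-close, \<open>p\<close> would follow \<open>y0\<close> on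
  \<open>{1..t}\<close>, against \<open>incomparable\<close>.\<close>

lemma horseshoe:
  assumes c: "c > 0" "\<And>x. c \<le> dist x (phi \<eta> x)" and \<eta>: "0 < \<eta>" "\<eta> \<le> 1 / 4"
    and \<epsilon>: "0 < \<epsilon>" "3 * \<epsilon> \<le> c" "\<epsilon> \<le> \<kappa>"
    and drift: "controls_drift \<kappa> \<eta>"
    and "t1 \<ge> 1" "t \<ge> 1"
    and shadow: "\<And>tt. (\<And>i. tt i = t1 \<or> tt i = t) \<Longrightarrow> \<exists>y h. shadows_loops phi \<epsilon> p tt y h"
    and y0: "shadows_loops phi \<epsilon> p (\<lambda>_. t1) y0 h0"
    and incomparable:
      "\<And>g. continuous_on UNIV g \<Longrightarrow> \<exists>u\<in>{1..t}. dist (phi u p) (phi (g u) y0) \<ge> 4 * \<epsilon>"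
  shows "growth_rate phi \<epsilon> > 0"
proof -
  define n where "n = \<lceil>6 * t + 2\<rceil>"
  have n: "n > 0" "of_int n \<ge> 6 * t + 2" using \<open>t \<ge> 1\<close> unfolding n_def by linarith+
  define m where "m = max t t1"
  have m: "m \<ge> 1" using \<open>t \<ge> 1\<close> by (simp add: m_def)
  \<comment> \<open>A block consists of \<open>n\<close> loops, all of length \<open>t1\<close> except the first one of the blocks in \<open>A\<close>;
    \<open>n\<close> is so large that a block of \<open>t1\<close>-loops outlasts the loop of length \<open>t\<close> despite the drift.\<close>
  define tt where "tt A i = (if n dvd i \<and> i div n \<in> A then t else t1)" for A i
  have tt: "1 \<le> tt A i" "tt A i \<le> m" for A i
    using \<open>t1 \<ge> 1\<close> \<open>t \<ge> 1\<close> by (auto simp: tt_def m_def)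
  have "\<exists>y h. shadows_loops phi \<epsilon> p (tt A) y h" for A
    by (rule shadow) (auto simp: tt_def)
  then obtain Y H where YH: "\<And>A. shadows_loops phi \<epsilon> p (tt A) (Y A) (H A)" by metis
  have H: "reparam (H A)" for A using YH by (simp add: shadows_loops_def)
  have H0 [simp]: "H A 0 = 0" for A using H by (simp add: reparam_def)
  have near: "dist (phi (H A (ssum (tt A) i + u)) (Y A)) (phi u p) < \<epsilon>"
    if "0 \<le> u" "u \<le> tt A i" for A i u
    using YH that unfolding shadows_loops_def by blast
  have H_cont: "continuous_on S (\<lambda>v. H A (r + v))" for A r S
    by (rule continuous_on_compose2[OF reparam_continuous_on[OF H, of UNIV]]) (auto intro: continuous_intros)
  have near': "dist (phi u p) (phi (H A (ssum (tt A) i + u)) (Y A)) < \<kappa>"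
    if "0 \<le> u" "u \<le> tt A i" for A i u
    using near[OF that] \<epsilon> by (simp add: dist_commute)
  have loop: "\<bar>H A (ssum (tt A) i + u) - H A (ssum (tt A) i) - u\<bar> \<le> \<eta> * (u + 1)"
    if "0 \<le> u" "u \<le> tt A i" for A i u
    using controls_driftD(1)[OF drift, of 0 u "\<lambda>v. H A (ssum (tt A) i + v)" p "Y A"] that H_cont near' by simp
  have loop1: "\<bar>H A (ssum (tt A) i + 1) - H A (ssum (tt A) i) - 1\<bar> < \<eta>" for A i
    using controls_driftD(2)[OF drift, of 0 1 "\<lambda>v. H A (ssum (tt A) i + v)" p "Y A"] tt(1)[of A i] H_cont near' by simp
  \<comment> \<open>The crude factors 3 here and \<open>1 / 2\<close> in \<open>loop_lower\<close>
    follow from \<open>\<eta> \<le> 1 / 4\<close> and durations of at least 1.\<close>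
  have loop_upper: "H A (ssum (tt A) i + u) \<le> H A (ssum (tt A) i) + 3 * u"
    if "1 \<le> u" "u \<le> tt A i" for A i u
  proof -
    have "\<eta> * (u + 1) \<le> 1 / 4 * (u + 1)" using that \<eta> by (intro mult_right_mono) auto
    moreover have "\<bar>H A (ssum (tt A) i + u) - H A (ssum (tt A) i) - u\<bar> \<le> \<eta> * (u + 1)"
      using that by (intro loop) auto
    ultimately show ?thesis using that by (simp add: abs_le_iff field_simps)
  qed
  have loop_lower: "H A (ssum (tt A) i) + 1 / 2 \<le> H A (ssum (tt A) (i + 1))" for A i
  proof -
    have "\<eta> * (tt A i + 1) \<le> 1 / 4 * (tt A i + 1)"
      using tt(1)[of A i] \<eta> by (intro mult_right_mono) auto
    moreover have "\<bar>H A (ssum (tt A) i + tt A i) - H A (ssum (tt A) i) - tt A i\<bar> \<le> \<eta> * (tt A i + 1)"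
      using order_trans[OF zero_le_one tt(1)] by (intro loop) auto
    ultimately show ?thesis using tt(1)[of A i] unfolding ssum_add_1 by (simp add: abs_le_iff field_simps)
  qed
  have upper: "H A (ssum (tt A) i) \<le> 3 * ssum (tt A) i" if "i \<ge> 0" for A i
    using that
  proof (induction i rule: int_ge_induct)
    case (step i)
    then show ?case using loop_upper[of "tt A i" A i] tt(1)[of A i] by (simp add: ssum_add_1)
  qed simp
  have lower: "H A (ssum (tt A) i) + of_int (j - i) / 2 \<le> H A (ssum (tt A) j)" if "i \<le> j" for A i j
    using that
  proof (induction j rule: int_ge_induct)
    case (step j)
    then show ?case using loop_lower[of A j] by (simp add: field_simps)
  qed simp
  have ssum_nonneg: "0 \<le> ssum (tt A) i" if "i \<ge> 0" for A i
    unfolding ssum_def using that tt(1)[of A] by (auto intro!: sum_nonneg intro: order_trans[OF zero_le_one])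
  have ssum_mono: "ssum (tt A) i \<le> ssum (tt A) j" if "i \<le> j" for A i j
    using that by (induction j rule: int_ge_induct)
      (auto simp: ssum_add_1 intro: order_trans[OF _ tt(1)] add_increasing2 order_trans[OF zero_le_one tt(1)])

  \<comment> \<open>A block lasts at most \<open>n * m\<close>, and at loop boundaries
    \<open>H A\<close> is at most 3 times the elapsed time, so \<open>N\<close> blocks are traced
    within \<open>N * M\<close>.\<close>
  define M where "M = 3 * of_int n * m"
  have "M > 0" using n m by (simp add: M_def)

  have apart: "\<exists>v. 0 \<le> v \<and> v \<le> real N * M \<and> dist (phi v (Y A)) (phi v (Y B)) \<ge> \<epsilon>"
    if k: "0 \<le> k" "k < int N" "k \<notin> A" "k \<in> B"
      and agree: "\<And>j. \<lbrakk>0 \<le> j; j < k\<rbrakk> \<Longrightarrow> j \<in> A \<longleftrightarrow> j \<in> B" for N k A B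
  proof (rule ccontr)
    assume "\<not> ?thesis"
    then have close: "dist (phi v (Y A)) (phi v (Y B)) < \<epsilon>" if "0 \<le> v" "v \<le> real N * M" for v
      using that by force
    have tt_eq: "tt A i = tt B i" if "0 \<le> i" "i < k * n" for i
    proof -
      have "n * (i div n) \<le> i"
        using pos_mod_sign[OF n(1), of i] mult_div_mod_eq[of n i] by linarith
      then have "n * (i div n) < n * k" using that by (simp add: mult.commute)
      then have "i div n < k" using n(1) by simp
      moreover have "0 \<le> i div n" using that n(1) by (simp add: pos_imp_zdiv_nonneg_iff)
      ultimately show ?thesis using agree by (simp add: tt_def)
    qed
    have kn: "0 \<le> k * n" using k n by simp
    \<comment> \<open>The common starting time of block \<open>k\<close>, the first block at which
      the codes differ.\<close>
    define s where "s = ssum (tt A) (k * n)"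
    have s_A: "ssum (tt A) i = ssum (tt B) i" if "0 \<le> i" "i \<le> k * n" for i
      using that tt_eq by (intro ssum_cong) auto
    have s_B: "ssum (tt B) (k * n) = s" using s_A[of "k * n"] kn by (simp add: s_def)
    have "s \<ge> 0" unfolding s_def by (rule ssum_nonneg[OF kn])
    have tB: "tt B (k * n) = t" using n k by (simp add: tt_def)
    have s_block: "ssum (tt A) (k * n + j) = s + of_int j * t1" if "0 \<le> j" "j \<le> n" for j
      using that
    proof (induction j rule: int_ge_induct)
      case (step j)
      have "tt A (k * n + j) = t1"
        using step k n by (auto simp: tt_def)
      then show ?case using step ssum_add_1[of "tt A" "k * n + j"] by (simp add: algebra_simps)
    qed (simp add: s_def)
    have sL: "3 * (s + t) \<le> real N * M"
    proof -
      have "s + t = ssum (tt B) (k * n + 1)" by (simp add: ssum_add_1 s_B tB)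
      also have "\<dots> \<le> m * of_int (k * n + 1)"
        using kn tt by (intro ssum_le) auto
      also have "k * n + 1 \<le> k * n + n" using n by simp
      also have "\<dots> = (k + 1) * n" by (simp add: algebra_simps)
      also have "\<dots> \<le> int N * n" using k n by (intro mult_right_mono) auto
      finally show ?thesis using m by (simp add: M_def mult.commute mult.left_commute)
    qed

    \<comment> \<open>Up to \<open>s\<close> both codes prescribe the same loops. With the assumed
      closeness of the traces, the orbit of \<open>Y A\<close> at times \<open>H A u\<close> and
      \<open>H B u\<close> is within \<open>3 * \<epsilon>\<close>, so \<open>no_drift\<close>
      applies.\<close>
    have "\<bar>H A s - H B s\<bar> < \<eta>"
    proof (rule no_drift[OF c(2) \<eta>(1) \<open>s \<ge> 0\<close>])
      fix u assume u: "u \<in> {0..s}"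
      \<comment> \<open>At \<open>u = s\<close> the pieces of index \<open>k * n\<close> may have
        different lengths, but only their common initial point is used.\<close>
      obtain i where i: "0 \<le> i" "i \<le> k * n" "ssum (tt A) i \<le> u"
          "u \<le> ssum (tt A) (i + 1)" "u \<le> ssum (tt B) (i + 1)"
      proof (cases "u < s")
        case True
        then obtain i where i: "0 \<le> i" "i < k * n" "ssum (tt A) i \<le> u" "u \<le> ssum (tt A) (i + 1)"
          using ssum_cover[of u "tt A" "k * n"] u kn unfolding s_def by auto
        then show ?thesis using s_A[of "i + 1"] by (intro that[of i]) auto
      next
        case False
        then have "u = s" using u by simp
        then show ?thesis
          using kn ssum_mono[of "k * n" "k * n + 1" A] ssum_mono[of "k * n" "k * n + 1" B] s_B
          by (intro that[of "k * n"]) (auto simp: s_def)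
      qed
      define w where "w = u - ssum (tt A) i"
      have "dist (phi (H A u) (Y A)) (phi w p) < \<epsilon>"
        using near[of w A i] i by (simp add: w_def ssum_add_1)
      moreover have "dist (phi (H B u) (Y B)) (phi w p) < \<epsilon>"
        using near[of w B i] i s_A[of i] by (simp add: w_def ssum_add_1)
      moreover have "dist (phi (H B u) (Y A)) (phi (H B u) (Y B)) < \<epsilon>"
      proof (rule close)
        show "0 \<le> H B u" using u reparam_le_iff[OF H, of B 0 u] by simp
        have "H B u \<le> H B s" using u reparam_le_iff[OF H] by simp
        also have "\<dots> \<le> 3 * s" using upper[OF kn, of B] s_B by simp
        finally show "H B u \<le> real N * M" using sL \<open>t \<ge> 1\<close> by simp
      qed
      ultimately have "dist (phi (H A u) (Y A)) (phi (H B u) (Y A)) < 3 * \<epsilon>" by metric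
      then show "dist (phi (H A u) (Y A)) (phi (H B u) (Y A)) < c" using \<epsilon> by simp
    qed (auto intro: reparam_continuous_on H)

    \<comment> \<open>\<open>H' (H B (s + u)) - s\<close> tells how far code \<open>A\<close> has
      advanced beyond \<open>s\<close> when the trace time is \<open>H B (s + u)\<close>; composed
      with \<open>h0\<close> it is a candidate for \<open>incomparable\<close>.\<close>
    obtain H' where H': "continuous_on UNIV H'" "\<And>v. H A (H' v) = v"
      using reparam_inverse[OF H[of A]] by metis
    have "continuous_on UNIV (\<lambda>u. H' (H B (s + u)) - s)"
      by (intro continuous_intros continuous_on_compose2[OF H'(1) H_cont]) auto
    then have "continuous_on UNIV (\<lambda>u. h0 (H' (H B (s + u)) - s))"
      using y0 reparam_continuous_on[of h0 UNIV] unfolding shadows_loops_def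
      by (auto intro: continuous_on_compose2)
    from incomparable[OF this] obtain u where u: "1 \<le> u" "u \<le> t"
      and far: "dist (phi u p) (phi (h0 (H' (H B (s + u)) - s)) y0) \<ge> 4 * \<epsilon>"
      by auto
    define w where "w = H' (H B (s + u)) - s"
    have w: "H A (s + w) = H B (s + u)" by (simp add: w_def H'(2))
    \<comment> \<open>As \<open>u \<ge> 1\<close>, code \<open>B\<close> has advanced by more than
      \<open>1 - \<eta>\<close>, which exceeds the lag \<eta> between the codes. Hence
      \<open>incomparable\<close> tests times from 1 on.\<close>
    have "H A s < H A (s + w)"
    proof -
      have "H B (s + 1) \<le> H B (s + u)" using u reparam_le_iff[OF H] by simp
      then show ?thesis
        using loop1[of B "k * n"] s_B w \<open>\<bar>H A s - H B s\<bar> < \<eta>\<close> \<eta> by simp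
    qed
    then have "w > 0" using reparam_less_iff[OF H] by fastforce
    \<comment> \<open>The size of \<open>n\<close> enters here: \<open>n / 2 \<ge> 3 * t + 1\<close>
      keeps the matched time inside block \<open>k\<close> of \<open>A\<close>.\<close>
    have "H A (s + w) < H A (s + of_int n * t1)"
    proof -
      have "H B (s + u) \<le> H B s + 3 * u" using loop_upper[of u B "k * n"] u s_B tB by simp
      moreover have "H A s + of_int n / 2 \<le> H A (s + of_int n * t1)"
        using lower[of "k * n" "k * n + n" A] n s_block[of n] by (simp add: s_def)
      ultimately show ?thesis
        using n u w \<open>\<bar>H A s - H B s\<bar> < \<eta>\<close> \<eta> by (simp add: field_simps)
    qed
    then have "w < of_int n * t1" using reparam_less_iff[OF H] by fastforce
    \<comment> \<open>The matched time lies in the \<open>t1\<close>-loop number \<open>j\<close> of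
      the block, at offset \<open>r\<close>; at time \<open>h0 w\<close> also \<open>y0\<close> is
      near \<open>phi r p\<close>.\<close>
    define j where "j = \<lfloor>w / t1\<rfloor>"
    have j: "0 \<le> j" "j < n"
      using \<open>w > 0\<close> \<open>w < of_int n * t1\<close> \<open>t1 \<ge> 1\<close> by (auto simp: j_def floor_less_iff field_simps)
    define r where "r = w - of_int j * t1"
    have "of_int j \<le> w / t1" "w / t1 \<le> of_int j + 1" by (simp_all add: j_def)
    then have r: "0 \<le> r" "r \<le> t1" using \<open>t1 \<ge> 1\<close> by (auto simp: r_def field_simps)
    have "tt A (k * n + j) = t1"
      using j k n by (auto simp: tt_def)
    then have "dist (phi (H A (s + w)) (Y A)) (phi r p) < \<epsilon>"
      using near[of r A "k * n + j"] r s_block[of j] j by (simp add: r_def)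
    moreover have "dist (phi (h0 w) y0) (phi r p) < \<epsilon>"
    proof -
      have "dist (phi (h0 (ssum (\<lambda>_. t1) j + r)) y0) (phi r p) < \<epsilon>"
        using y0 r unfolding shadows_loops_def by blast
      then show ?thesis by (simp add: ssum_const r_def)
    qed
    moreover have "dist (phi (H B (s + u)) (Y B)) (phi u p) < \<epsilon>"
      using near[of u B "k * n"] u s_B tB by simp
    moreover have "dist (phi (H B (s + u)) (Y A)) (phi (H B (s + u)) (Y B)) < \<epsilon>"
    proof (rule close)
      show "0 \<le> H B (s + u)" using u \<open>s \<ge> 0\<close> reparam_le_iff[OF H, of B 0 "s + u"] by simp
      have "H B (s + u) \<le> H B s + 3 * u" using loop_upper[of u B "k * n"] u s_B tB by simp
      then show "H B (s + u) \<le> real N * M" using sL u upper[OF kn, of B] s_B by simp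
    qed
    \<comment> \<open>Four errors \<epsilon> add up: from \<open>phi u p\<close> to the trace of
      \<open>B\<close>, to that of \<open>A\<close>, to \<open>phi r p\<close>, to
      \<open>phi (h0 w) y0\<close>.\<close>
    ultimately have "dist (phi u p) (phi (h0 w) y0) < 4 * \<epsilon>" unfolding w by metric
    with far show False by (simp add: w_def)
  qed

  have sep: "\<exists>v. 0 \<le> v \<and> v \<le> real N * M \<and> dist (phi v (Y A)) (phi v (Y B)) \<ge> \<epsilon>"
    if "A \<subseteq> {0..<int N}" "B \<subseteq> {0..<int N}" "A \<noteq> B" for A B N
  proof -
    define D where "D = (A - B) \<union> (B - A)"
    have D: "D \<noteq> {}" "D \<subseteq> {0..<int N}"
      using that by (auto simp: D_def)
    then have "finite D" by (metis finite_atLeastLessThan_int finite_subset)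
    define k where "k = Min D"
    have k: "k \<in> D" using Min_in[OF \<open>finite D\<close> D(1)] by (simp add: k_def)
    have below: "j \<in> A \<longleftrightarrow> j \<in> B" if "j < k" for j
    proof -
      have "j \<notin> D" using Min_le[OF \<open>finite D\<close>, of j] that by (fastforce simp: k_def)
      then show ?thesis by (auto simp: D_def)
    qed
    have k': "0 \<le> k" "k < int N" using D(2) k by auto
    show ?thesis
    proof (cases "k \<in> A")
      case True
      then have "k \<notin> B" using k by (simp add: D_def)
      from apart[OF k' this True] below show ?thesis by (simp add: dist_commute)
    next
      case False
      then have "k \<in> B" using k by (simp add: D_def)
      from apart[OF k' False this] below show ?thesis by blast
    qed
  qed
  show ?thesis
  proof (rule growth_rate_pos[OF \<open>M > 0\<close>])
    fix N :: nat assume "N \<ge> 1"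
    have "inj_on Y (Pow {0..<int N})"
    proof
      fix A B assume "A \<in> Pow {0..<int N}" "B \<in> Pow {0..<int N}" "Y A = Y B"
      then show "A = B" using sep[of A N B] \<epsilon>(1) by auto
    qed
    then have "card (Y ` Pow {0..<int N}) = 2 ^ N" by (simp add: card_image card_Pow)
    moreover have "separated phi (real N * M) \<epsilon> (Y ` Pow {0..<int N})"
      unfolding separated_def
    proof (intro ballI impI)
      fix x y assume "x \<in> Y ` Pow {0..<int N}" "y \<in> Y ` Pow {0..<int N}" "x \<noteq> y"
      then obtain A B where "A \<subseteq> {0..<int N}" "B \<subseteq> {0..<int N}" "x = Y A" "y = Y B" "A \<noteq> B"
        by blast
      then show "\<exists>u\<ge>0. u \<le> real N * M \<and> dist (phi u x) (phi u y) \<ge> \<epsilon>"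
        using sep[of A N B] by blast
    qed
    moreover have "finite (Y ` Pow {0..<int N})" by simp
    ultimately show "\<exists>E. finite E \<and> card E = 2 ^ N \<and> separated phi (real N * M) \<epsilon> E"
      by blast
  qed
qed

end

section \<open>Folding time along the repeated loop, and the dichotomy\<close>

lemma shadows_loops_periodic:
  assumes y: "shadows_loops phi \<epsilon> p (\<lambda>_. t) y h" and "t > 0"
  shows "dist (phi (h w) y) (phi (h (w - of_int j * t)) y) < 2 * \<epsilon>"
proof -
  \<comment> \<open>Both times have the same offset \<open>r\<close> in their loops, so both points
    are near \<open>phi r p\<close>.\<close>
  define i where "i = \<lfloor>w / t\<rfloor>"
  define r where "r = w - of_int i * t"
  have "of_int i \<le> w / t" "w / t \<le> of_int i + 1" by (simp_all add: i_def)
  then have r: "0 \<le> r" "r \<le> t" using \<open>t > 0\<close> by (auto simp: r_def field_simps)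
  have near: "dist (phi (h (of_int k * t + r)) y) (phi r p) < \<epsilon>" for k
    using y r ssum_const[of t k] unfolding shadows_loops_def by metis
  have "w = of_int i * t + r" "w - of_int j * t = of_int (i - j) * t + r"
    by (simp_all add: r_def algebra_simps)
  then have "dist (phi (h w) y) (phi r p) < \<epsilon>" "dist (phi (h (w - of_int j * t)) y) (phi r p) < \<epsilon>"
    using near by metis+
  then show ?thesis by metric
qed

lemma (in compact_flow) orbit_trans:
  assumes "x \<in> orbit phi y" "y \<in> orbit phi z"
  shows "x \<in> orbit phi z"
  using assms by (auto simp: orbit_def simp flip: phi_add)

lemma (in compact_flow) orbit_sym:
  assumes "x \<in> orbit phi y"
  shows "y \<in> orbit phi x"
proof -
  obtain t where "x = phi t y" using assms unfolding orbit_def by blast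
  then have "y = phi (- t) x" by (simp flip: phi_add)
  then show ?thesis unfolding orbit_def by blast
qed

theorem theoremB:
  fixes phi :: "real \<Rightarrow> 'a::metric_space \<Rightarrow> 'a" and p :: 'a
  assumes "compact (UNIV :: 'a set)"
    and "is_flow phi"
    and "\<forall>x. \<not> singularity phi x"
    and "p \<in> nonwandering_set phi - Per phi"
    and "shadowable_pt phi p"
    and "unif_expansive_pt phi p"
  shows "top_entropy phi > 0"
proof -
  interpret compact_flow phi using assms by unfold_locales
  have p: "p \<in> nonwandering_set phi" "p \<notin> Per phi" using assms(4) by auto
  obtain U where U: "open U" "p \<in> U" and "\<forall>\<epsilon>>0. \<exists>\<delta>>0. \<forall>y\<in>U. \<forall>z\<in>U. \<forall>h.
      reparam h \<and> (\<forall>t. dist (phi t y) (phi (h t) z) < \<delta>) \<longrightarrow>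
      (\<exists>w\<in>orbit phi z. \<exists>t. \<bar>t\<bar> < \<epsilon> \<and> y = phi t w)"
    using assms(6) unfolding unif_expansive_pt_def by blast
  from this(3)[rule_format, OF zero_less_one] obtain \<delta> where "\<delta> > 0"
    and \<delta>: "\<And>y z h. \<lbrakk>y \<in> U; z \<in> U; reparam h; \<And>t. dist (phi t y) (phi (h t) z) < \<delta>\<rbrakk> \<Longrightarrow>
      \<exists>w\<in>orbit phi z. \<exists>t. y = phi t w"
    by blast
  \<comment> \<open>Expansivity is taken at scale 1; the time shift is absorbed into the
    orbit.\<close>
  have expansive: "y \<in> orbit phi z"
    if close: "y \<in> U" "z \<in> U" "reparam h" "\<And>t. dist (phi t y) (phi (h t) z) < \<delta>" for y z h
  proof -
    obtain w t where "w \<in> orbit phi z" "y = phi t w" using \<delta>[OF close] by blast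
    then show ?thesis using orbit_trans unfolding orbit_def by blast
  qed
  obtain \<rho> where \<rho>: "\<rho> > 0" "ball p \<rho> \<subseteq> U" using U open_contains_ball by blast
  \<comment> \<open>\<delta> triggers expansivity, while \<open>\<rho> / 2\<close> keeps the
    companion \<open>phi v y\<close> of a point \<open>q\<close> near \<open>p\<close> inside
    \<open>U\<close>.\<close>
  have "min \<delta> (\<rho> / 2) > 0" using \<open>\<delta> > 0\<close> \<open>\<rho> > 0\<close> by simp
  from limit_of_fellow_travellers[OF assms(3) this]
  obtain \<kappa>1 where "\<kappa>1 > 0" and limit: "\<And>x q y G B. \<lbrakk>x \<longlonglongrightarrow> q; \<And>n. continuous_on UNIV (G n); \<And>n. \<bar>G n 0\<bar> \<le> B;
      \<And>n u. \<bar>u\<bar> \<le> real n \<Longrightarrow> dist (phi u (x n)) (phi (G n u) y) < \<kappa>1\<rbrakk> \<Longrightarrow>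
      \<exists>v h. reparam h \<and> (\<forall>t. dist (phi t q) (phi (h t) (phi v y)) < min \<delta> (\<rho> / 2))"
    by blast
  obtain \<eta>\<^sub>0 where \<eta>\<^sub>0: "\<eta>\<^sub>0 > 0" "\<And>u x. \<lbrakk>0 < u; u \<le> \<eta>\<^sub>0\<rbrakk> \<Longrightarrow> phi u x \<noteq> x"
    using fixed_times_bounded_below[OF assms(3)] by blast
  define \<eta> where "\<eta> = min \<eta>\<^sub>0 (1 / 4)"
  have \<eta>: "0 < \<eta>" "\<eta> \<le> \<eta>\<^sub>0" "\<eta> \<le> 1 / 4" using \<eta>\<^sub>0 by (auto simp: \<eta>_def)
  obtain c where c: "c > 0" "\<And>x. c \<le> dist x (phi \<eta> x)"
    using displacement_bounded_below[of \<eta>] \<eta>\<^sub>0(2) \<eta> by metis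
  obtain \<kappa>2 where "\<kappa>2 > 0" and drift: "controls_drift \<kappa>2 \<eta>"
    using controls_drift_exists[OF c \<eta>(1)] by blast
  \<comment> \<open>\<open>\<kappa>1 / 6\<close> leaves room for the sum
    \<open>4 * \<epsilon> + 2 * \<epsilon>\<close> in the second case; \<open>\<kappa>2\<close> and
    \<open>c / 3\<close> serve the drift estimates in \<open>horseshoe\<close>.\<close>
  define \<epsilon> where "\<epsilon> = min (\<kappa>1 / 6) (min \<kappa>2 (c / 3))"
  have \<epsilon>: "0 < \<epsilon>" "3 * \<epsilon> \<le> c" "\<epsilon> \<le> \<kappa>2" "6 * \<epsilon> \<le> \<kappa>1"
    using \<open>\<kappa>1 > 0\<close> \<open>\<kappa>2 > 0\<close> \<open>c > 0\<close> by (auto simp: \<epsilon>_def min_def)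
  obtain \<delta>1 where "\<delta>1 > 0" and shadow:
    "\<And>tt. (\<And>i. tt i \<ge> 1 \<and> dist (phi (tt i) p) p < \<delta>1) \<Longrightarrow> \<exists>y h. shadows_loops phi \<epsilon> p tt y h"
    using shadows_loops_exists[OF assms(5) \<epsilon>(1)] by blast
  have returns: "\<exists>t\<ge>T. dist (phi t p) p < \<delta>1" for T
    using nonwandering_recurrent[OF p(1), of "ball p \<delta>1" T] \<open>\<delta>1 > 0\<close> by (auto simp: dist_commute)
  then obtain t1 where t1: "t1 \<ge> 1" "dist (phi t1 p) p < \<delta>1" by blast
  then obtain y h where yh: "shadows_loops phi \<epsilon> p (\<lambda>_. t1) y h" using shadow[of "\<lambda>_. t1"] by blast
  show ?thesis
  proof (cases "\<exists>t\<ge>1. dist (phi t p) p < \<delta>1 \<and>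
      (\<forall>g. continuous_on UNIV g \<longrightarrow> (\<exists>u\<in>{1..t}. dist (phi u p) (phi (g u) y) \<ge> 4 * \<epsilon>))")
    case True
    then obtain t where t: "t \<ge> 1" "dist (phi t p) p < \<delta>1"
      "\<And>g. continuous_on UNIV g \<Longrightarrow> \<exists>u\<in>{1..t}. dist (phi u p) (phi (g u) y) \<ge> 4 * \<epsilon>" by blast
    have "\<exists>y h. shadows_loops phi \<epsilon> p tt y h" if "\<And>i. tt i = t1 \<or> tt i = t" for tt
      by (rule shadow) (metis that t1 t(1,2))
    from horseshoe[OF c \<eta>(1,3) \<epsilon>(1-3) drift t1(1) t(1) this yh t(3)]
    have "growth_rate phi \<epsilon> > 0" .
    then show ?thesis using growth_rate_le_top_entropy[OF \<epsilon>(1)] by (rule less_le_trans)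
  next
    case False
    then have follows: "\<exists>g. continuous_on UNIV g \<and> (\<forall>u\<in>{1..t}. dist (phi u p) (phi (g u) y) < 4 * \<epsilon>)"
      if "t \<ge> 1" "dist (phi t p) p < \<delta>1" for t
      using that by (meson not_le)
    have h: "reparam h" using yh by (simp add: shadows_loops_def)
    obtain h' where h': "continuous_on UNIV h'" "\<And>v. h (h' v) = v"
      using reparam_inverse[OF h] by metis
    have in_orbit: "q \<in> orbit phi y"
      if "dist p q < \<rho> / 2" and q: "\<And>V T. \<lbrakk>open V; q \<in> V\<rbrakk> \<Longrightarrow> \<exists>t\<ge>T. phi t p \<in> V" for q
    proof -
      have "\<exists>r\<ge>real n + 1. dist (phi r p) q < inverse (real (Suc n))" for n
        using q[of "ball q (inverse (real (Suc n)))" "real n + 1"] by (auto simp: dist_commute)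
      then obtain r where r: "\<And>n. r n \<ge> real n + 1" "\<And>n. dist (phi (r n) p) q < inverse (real (Suc n))"
        by metis
      \<comment> \<open>Following up to a later return time includes the window of radius
        \<open>n\<close> around \<open>r n\<close>, which starts no earlier than 1 because
        \<open>r n \<ge> n + 1\<close>.\<close>
      have "\<exists>g. continuous_on UNIV g \<and> (\<forall>u\<in>{1..r n + n}. dist (phi u p) (phi (g u) y) < 4 * \<epsilon>)" for n
      proof -
        obtain t where t: "t \<ge> max 1 (r n + n)" "dist (phi t p) p < \<delta>1" using returns by blast
        with follows[of t] obtain g where
          "continuous_on UNIV g" "\<forall>u\<in>{1..t}. dist (phi u p) (phi (g u) y) < 4 * \<epsilon>" by auto
        with t show ?thesis by (intro exI[of _ g]) auto
      qed
      then obtain g where g: "\<And>n. continuous_on UNIV (g n)"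
        "\<And>n u. \<lbrakk>1 \<le> u; u \<le> r n + n\<rbrakk> \<Longrightarrow> dist (phi u p) (phi (g n u) y) < 4 * \<epsilon>"
        by (metis atLeastAtMost_iff)
      \<comment> \<open>Subtracting multiples of \<open>t1\<close> before applying \<open>h\<close>
        brings the argument at \<open>u = 0\<close> into \<open>[0, t1]\<close> and so bounds
        \<open>G n 0\<close>; by \<open>shadows_loops_periodic\<close> this costs less than
        \<open>2 * \<epsilon>\<close>.\<close>
      define j where "j n = \<lfloor>h' (g n (r n)) / t1\<rfloor>" for n
      define G where "G n u = h (h' (g n (r n + u)) - of_int (j n) * t1)" for n u
      have "(\<lambda>n. phi (r n) p) \<longlonglongrightarrow> q"
      proof (rule metric_tendsto_imp_tendsto[OF LIMSEQ_inverse_real_of_nat])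
        show "\<forall>\<^sub>F n in sequentially. dist (phi (r n) p) q \<le> dist (inverse (real (Suc n))) 0"
          using r(2) less_imp_le by (intro always_eventually) fastforce
      qed
      moreover have "continuous_on UNIV (G n)" for n
        unfolding G_def
        by (intro continuous_on_compose2[OF reparam_continuous_on[OF h, of UNIV]]
            continuous_on_compose2[OF h'(1)] continuous_on_compose2[OF g(1)[of n]] continuous_intros) auto
      moreover have "\<bar>G n 0\<bar> \<le> h t1" for n
      proof -
        define w where "w = h' (g n (r n)) - of_int (j n) * t1"
        have "of_int (j n) \<le> h' (g n (r n)) / t1" "h' (g n (r n)) / t1 \<le> of_int (j n) + 1"
          by (simp_all add: j_def)
        then have "0 \<le> w" "w \<le> t1" using t1(1) by (auto simp: w_def field_simps)
        then have "h 0 \<le> h w" "h w \<le> h t1" using reparam_le_iff[OF h] by auto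
        moreover have "h 0 = 0" using h by (simp add: reparam_def)
        ultimately show ?thesis by (simp add: G_def w_def)
      qed
      moreover have "dist (phi u (phi (r n) p)) (phi (G n u) y) < \<kappa>1" if "\<bar>u\<bar> \<le> real n" for n u
      proof -
        have "dist (phi u (phi (r n) p)) (phi (g n (r n + u)) y) < 4 * \<epsilon>"
          using g(2)[of "r n + u" n] that r(1)[of n] by (simp add: phi_add abs_le_iff)
        moreover have "dist (phi (g n (r n + u)) y) (phi (G n u) y) < 2 * \<epsilon>"
          using shadows_loops_periodic[OF yh, of "h' (g n (r n + u))" "j n"] t1(1)
          by (simp add: G_def h'(2))
        ultimately have "dist (phi u (phi (r n) p)) (phi (G n u) y) < 6 * \<epsilon>" by metric
        then show ?thesis using \<epsilon>(4) by simp
      qed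
      ultimately obtain v k where k: "reparam k"
        "\<And>t. dist (phi t q) (phi (k t) (phi v y)) < min \<delta> (\<rho> / 2)"
        using limit[of "\<lambda>n. phi (r n) p" q G "h t1" y] by blast
      have "dist q (phi v y) < \<rho> / 2" using k(2)[of 0] k(1) by (simp add: reparam_def)
      moreover have "dist p (phi v y) \<le> dist p q + dist q (phi v y)" by (rule dist_triangle)
      ultimately have "dist p q < \<rho>" "dist p (phi v y) < \<rho>"
        using \<open>dist p q < \<rho> / 2\<close> \<open>\<rho> > 0\<close> by linarith+
      then have "q \<in> U" "phi v y \<in> U" using \<rho>(2) by auto
      then have "q \<in> orbit phi (phi v y)" using expansive[of q "phi v y" k] k by simp
      moreover have "phi v y \<in> orbit phi y" unfolding orbit_def by blast
      ultimately show ?thesis by (rule orbit_trans)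
    qed
    \<comment> \<open>By recurrence \<open>p\<close> itself qualifies for \<open>in_orbit\<close>,
      so \<open>p\<close> and \<open>y\<close> have the same orbit, and the point \<open>q\<close>
      off it gives the contradiction.\<close>
    have "p \<in> orbit phi y" using in_orbit[of p] \<open>\<rho> > 0\<close> nonwandering_recurrent[OF p(1)] by simp
    moreover obtain q where "dist p q < \<rho> / 2" "q \<notin> orbit phi p"
      "\<And>V T. \<lbrakk>open V; q \<in> V\<rbrakk> \<Longrightarrow> \<exists>t\<ge>T. phi t p \<in> V"
      using omega_limit_point_off_orbit[OF p, of "\<rho> / 2"] \<open>\<rho> > 0\<close> by auto
    ultimately show ?thesis using in_orbit[of q] orbit_sym orbit_trans by blast
  qed
qed

end
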